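(* Let $(A,\mu_1,\mu_2)$ be a compatible associative algebra. Then the map $\phi: C^n_c(A,A)\to C^n(A,A)$, $(f_1,\ldots,f_n)\mapsto f_1+\cdots+f_n$ ($n\geq 1$), induces a morphism $$\phi_*: H^*_c(A,A)\to H^*(A,A),\qquad *\ge 1,$$ from the cohomology of the compatible associative algebra $(A,\mu_1,\mu_2)$ with coefficients in itself to the Hochschild cohomology of the associative algebra $(A,\mu_1+\mu_2)$ with coefficients in itself.
   Context: All vector spaces are finite-dimensional over a field $\mathbb{K}$ of characteristic $0$. A compatible associative algebra is a triple $(A,\mu_1,\mu_2)$ of a vector space with two associative bilinear products, written $a\cdot_1 b$ and $a\cdot_2 b$, with $(a\cdot_1 b)\cdot_2 c+(a\cdot_2 b)\cdot_1 c=a\cdot_1(b\cdot_2 c)+a\cdot_2(b\cdot_1 c)$ for all $a,b,c$; then $(A,\mu_1+\mu_2)$ is associative. For $n\ge 0$ let $C^n(A,A)=\mathrm{Hom}(A^{\otimes n},A)$. For an associative product $\cdot$ on $A$, the Hochschild coboundary $\delta:C^n(A,A)\to C^{n+1}(A,A)$ is $$(\delta f)(a_1,\ldots,a_{n+1})=a_1\cdot f(a_2,\ldots,a_{n+1})+\sum_{i=1}^n(-1)^if(a_1,\ldots,a_i\cdot a_{i+1},\ldots,a_{n+1})+(-1)^{n+1}f(a_1,\ldots,a_n)\cdot a_{n+1},$$ and its cohomology is denoted $H^*(A,A)$. Let $\delta_1,\delta_2$ be the Hochschild coboundaries for $\mu_1,\mu_2$ respectively. The cohomology $H^*_c(A,A)$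 of $(A,\mu_1,\mu_2)$ with coefficients in itself is the cohomology of the cochain complex with $C^0_c(A,A)=\{m\in A\mid a\cdot_1m-m\cdot_1a=a\cdot_2m-m\cdot_2a\ \forall a\in A\}$, $C^n_c(A,A)=C^n(A,A)^{\oplus n}$ for $n\ge1$, and coboundary $\delta_c$ given by $\delta_c(m)(a)=a\cdot_1m-m\cdot_1a=a\cdot_2m-m\cdot_2a$ on $C^0_c$, and for $n\geq1$, $\delta_c(f_1,\ldots,f_n)=(\delta_1f_1,\ldots,\delta_1f_i+\delta_2f_{i-1},\ldots,\delta_2f_n)$, where $\delta_1f_i+\delta_2f_{i-1}$ is the $i$-th entry for $2\le i\le n$. *)

theory Defs
  imports
    Complex_Main
    "HOL-Library.FuncSet"
    "HOL-Library.Function_Algebras"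
    "HOL-Library.Set_Algebras"
begin

section \<open>Compatible associative algebras\<close>

locale associative_algebra = vector_space scale
  for scale :: "'k::field_char_0 \<Rightarrow> 'a::ab_group_add \<Rightarrow> 'a" +
  fixes mu :: "'a \<Rightarrow> 'a \<Rightarrow> 'a"
  assumes finite_dimensional: "\<exists>Basis. finite_dimensional_vector_space scale Basis"
    and linear_left: "Vector_Spaces.linear scale scale (\<lambda>a. mu a b)"
    and linear_right: "Vector_Spaces.linear scale scale (\<lambda>b. mu a b)"
    and assoc: "mu (mu a b) c = mu a (mu b c)"

locale compatible_associative_algebra =
  A1: associative_algebra scale mu1 + A2: associative_algebra scale mu2
  for scale :: "'k::field_char_0 \<Rightarrow> 'a::ab_group_add \<Rightarrow> 'a"
    and mu1 mu2 :: "'a \<Rightarrow> 'a \<Rightarrow> 'a" +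
  assumes compatible:
    "mu2 (mu1 a b) c + mu1 (mu2 a b) c = mu1 a (mu2 b c) + mu2 a (mu1 b c)"

definition sum_product :: "('a \<Rightarrow> 'a \<Rightarrow> 'a) \<Rightarrow> ('a \<Rightarrow> 'a \<Rightarrow> 'a) \<Rightarrow> 'a \<Rightarrow> 'a \<Rightarrow> 'a::ab_group_add" where
  "sum_product mu1 mu2 a b = mu1 a b + mu2 a b"

lemma (in compatible_associative_algebra) associative_sum_product:
  "associative_algebra scale (sum_product mu1 mu2)"
proof -
  interpret vector_space_pair scale scale ..
  have add: "mu1 (x + y) c = mu1 x c + mu1 y c" "mu1 c (x + y) = mu1 c x + mu1 c y"
    "mu2 (x + y) c = mu2 x c + mu2 y c" "mu2 c (x + y) = mu2 c x + mu2 c y" for x y c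
    using linear_add[OF A1.linear_left] linear_add[OF A1.linear_right]
      linear_add[OF A2.linear_left] linear_add[OF A2.linear_right] by blast+
  show ?thesis
  proof (intro associative_algebra.intro associative_algebra_axioms.intro)
    show "vector_space scale" ..
    show "\<exists>Basis. finite_dimensional_vector_space scale Basis"
      by (rule A1.finite_dimensional)
    show "Vector_Spaces.linear scale scale (\<lambda>a. sum_product mu1 mu2 a b)" for b
      unfolding sum_product_def
      by (rule linear_compose_add[OF A1.linear_left A2.linear_left])
    show "Vector_Spaces.linear scale scale (\<lambda>b. sum_product mu1 mu2 a b)" for a
      unfolding sum_product_def
      by (rule linear_compose_add[OF A1.linear_right A2.linear_right])
    show "sum_product mu1 mu2 (sum_product mu1 mu2 a b) c =
        sum_product mu1 mu2 a (sum_product mu1 mu2 b c)" for a b c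
      using compatible[of a b c]
      by (simp add: sum_product_def add A1.assoc A2.assoc algebra_simps)
  qed
qed


section \<open>The Hochschild complex\<close>

text \<open>
  Maps out of the n-th tensor power of A are multilinear maps in n arguments. The argument tuple
  (a_1, ..., a_n) is a list of length n (so a_i is the entry with index i - 1), and a cochain is
  set to 0 on lists of any other length, which makes equality of functions equality of cochains.
  A 0-cochain f is the element f [] of A.
\<close>

definition hochschild_cochains ::
    "('k::field \<Rightarrow> 'a::ab_group_add \<Rightarrow> 'a) \<Rightarrow> nat \<Rightarrow> ('a list \<Rightarrow> 'a) set" where
  "hochschild_cochains scale n =
    {f. (\<forall>xs i. length xs = n \<and> i < n \<longrightarrow> Vector_Spaces.linear scale scale (\<lambda>x. f (xs[i := x]))) \<and>
        (\<forall>xs. length xs \<noteq> n \<longrightarrow> f xs = 0)}"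

text \<open>
  In the i-th summand the list is (a_1, ..., a_{i-1}, a_i a_{i+1}, a_{i+2}, ..., a_{n+1}).
\<close>

definition hochschild_coboundary ::
    "('k::field \<Rightarrow> 'a::ab_group_add \<Rightarrow> 'a) \<Rightarrow> ('a \<Rightarrow> 'a \<Rightarrow> 'a) \<Rightarrow> nat \<Rightarrow> ('a list \<Rightarrow> 'a) \<Rightarrow> 'a list \<Rightarrow> 'a" where
  "hochschild_coboundary scale mu n f xs =
    (if length xs = n + 1 then
       mu (hd xs) (f (tl xs))
       + (\<Sum>i = 1..n. scale ((- 1) ^ i) (f (take (i - 1) xs @ [mu (xs ! (i - 1)) (xs ! i)] @ drop (i + 1) xs)))
       + scale ((- 1) ^ (n + 1)) (mu (f (butlast xs)) (last xs))
     else 0)"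

definition cochain_scale :: "('k \<Rightarrow> 'a \<Rightarrow> 'a) \<Rightarrow> 'k \<Rightarrow> ('a list \<Rightarrow> 'a) \<Rightarrow> 'a list \<Rightarrow> 'a" where
  "cochain_scale scale c f = (\<lambda>xs. scale c (f xs))"


section \<open>The complex of a compatible associative algebra\<close>

text \<open>
  A tuple (f_1, ..., f_n) of cochains is a function on indices that vanishes outside {1..n}.
  An element m of the degree 0 space is likewise stored as a one-entry tuple, at index 1, whose
  entry is the Hochschild 0-cochain with value m. Thus the complex lives in a single type.
\<close>

definition compat_cochains ::
    "('k::field \<Rightarrow> 'a::ab_group_add \<Rightarrow> 'a) \<Rightarrow> ('a \<Rightarrow> 'a \<Rightarrow> 'a) \<Rightarrow> ('a \<Rightarrow> 'a \<Rightarrow> 'a) \<Rightarrow> nat \<Rightarrow>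
      (nat \<Rightarrow> 'a list \<Rightarrow> 'a) set" where
  "compat_cochains scale mu1 mu2 n =
    (if n = 0 then
       {F. F 1 \<in> hochschild_cochains scale 0 \<and> (\<forall>i. i \<noteq> 1 \<longrightarrow> F i = 0) \<and>
           (\<forall>a. mu1 a (F 1 []) - mu1 (F 1 []) a = mu2 a (F 1 []) - mu2 (F 1 []) a)}
     else
       {F. (\<forall>i\<in>{1..n}. F i \<in> hochschild_cochains scale n) \<and> (\<forall>i. i \<notin> {1..n} \<longrightarrow> F i = 0)})"

definition compat_coboundary ::
    "('k::field \<Rightarrow> 'a::ab_group_add \<Rightarrow> 'a) \<Rightarrow> ('a \<Rightarrow> 'a \<Rightarrow> 'a) \<Rightarrow> ('a \<Rightarrow> 'a \<Rightarrow> 'a) \<Rightarrow> nat \<Rightarrow>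
      (nat \<Rightarrow> 'a list \<Rightarrow> 'a) \<Rightarrow> nat \<Rightarrow> 'a list \<Rightarrow> 'a" where
  "compat_coboundary scale mu1 mu2 n F i =
    (if n = 0 then
       (if i = 1
        then (\<lambda>xs. if length xs = 1 then mu1 (hd xs) (F 1 []) - mu1 (F 1 []) (hd xs) else 0)
        else 0)
     else if i = 1 then hochschild_coboundary scale mu1 n (F 1)
     else if 2 \<le> i \<and> i \<le> n then
       hochschild_coboundary scale mu1 n (F i) + hochschild_coboundary scale mu2 n (F (i - 1))
     else if i = n + 1 then hochschild_coboundary scale mu2 n (F n)
     else 0)"

definition tuple_scale ::
    "('k \<Rightarrow> 'a \<Rightarrow> 'a) \<Rightarrow> 'k \<Rightarrow> (nat \<Rightarrow> 'a list \<Rightarrow> 'a) \<Rightarrow> nat \<Rightarrow> 'a list \<Rightarrow> 'a" where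
  "tuple_scale scale c F = (\<lambda>i. cochain_scale scale c (F i))"

definition compat_to_hochschild :: "nat \<Rightarrow> (nat \<Rightarrow> 'a list \<Rightarrow> 'a) \<Rightarrow> 'a list \<Rightarrow> 'a::ab_group_add" where
  "compat_to_hochschild n F = (\<Sum>i = 1..n. F i)"


section \<open>Cohomology of a cochain complex\<close>

definition cocycles :: "(nat \<Rightarrow> 'v set) \<Rightarrow> (nat \<Rightarrow> 'v \<Rightarrow> 'v) \<Rightarrow> nat \<Rightarrow> 'v::ab_group_add set" where
  "cocycles C d n = {z \<in> C n. d n z = 0}"

definition coboundaries :: "(nat \<Rightarrow> 'v set) \<Rightarrow> (nat \<Rightarrow> 'v \<Rightarrow> 'v) \<Rightarrow> nat \<Rightarrow> 'v::ab_group_add set" where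
  "coboundaries C d n = (case n of 0 \<Rightarrow> {0} | Suc k \<Rightarrow> d k ` C k)"

definition cohomology_class ::
    "(nat \<Rightarrow> 'v set) \<Rightarrow> (nat \<Rightarrow> 'v \<Rightarrow> 'v) \<Rightarrow> nat \<Rightarrow> 'v \<Rightarrow> 'v::ab_group_add set" where
  "cohomology_class C d n z = z +o coboundaries C d n"

definition cohomology ::
    "(nat \<Rightarrow> 'v set) \<Rightarrow> (nat \<Rightarrow> 'v \<Rightarrow> 'v) \<Rightarrow> nat \<Rightarrow> 'v::ab_group_add set set" where
  "cohomology C d n = cohomology_class C d n ` cocycles C d n"

text \<open>
  Addition of cosets is the elementwise sum of sets from \<^theory>\<open>HOL-Library.Set_Algebras\<close>.
  In a scalar multiple of a coset the summand B is needed for the scalar 0.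
\<close>

definition coset_scale ::
    "('k \<Rightarrow> 'v \<Rightarrow> 'v) \<Rightarrow> 'v set \<Rightarrow> 'k \<Rightarrow> 'v set \<Rightarrow> 'v::ab_group_add set" where
  "coset_scale s B c X = s c ` X + B"

lemma coset_plus_coset:
  fixes s :: "'k::field \<Rightarrow> 'v::ab_group_add \<Rightarrow> 'v"
  assumes "vector_space s" "module.subspace s B"
  shows "(x +o B) + (y +o B) = (x + y) +o B"
proof -
  interpret vector_space s by fact
  have "B + B = B"
  proof
    show "B + B \<subseteq> B" using assms(2) by (auto simp: set_plus_def subspace_add)
    have "b \<in> B + B" if "b \<in> B" for b
      using set_plus_intro[OF that subspace_0[OF assms(2)]] by simp
    then show "B \<subseteq> B + B" by blast
  qed
  then show ?thesis by (simp add: set_plus_rearrange)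
qed

lemma coset_scale_coset:
  fixes s :: "'k::field \<Rightarrow> 'v::ab_group_add \<Rightarrow> 'v"
  assumes "vector_space s" "module.subspace s B"
  shows "coset_scale s B c (x +o B) = s c x +o B"
proof -
  interpret vector_space s by fact
  show ?thesis
  proof (intro equalityI subsetI)
    fix v assume "v \<in> coset_scale s B c (x +o B)"
    then obtain b b' where "b \<in> B" "b' \<in> B" "v = s c (x + b) + b'"
      by (auto simp: coset_scale_def set_plus_def elt_set_plus_def)
    moreover from this have "s c b + b' \<in> B"
      using assms(2) by (simp add: subspace_add subspace_scale)
    ultimately show "v \<in> s c x +o B"
      by (auto simp: elt_set_plus_def scale_right_distrib add.assoc)
  next
    fix v assume "v \<in> s c x +o B"
    then obtain b where b: "b \<in> B" "v = s c x + b" by (auto simp: elt_set_plus_def)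
    have "x \<in> x +o B" using set_plus_intro2[OF subspace_0[OF assms(2)], of x] by simp
    with b show "v \<in> coset_scale s B c (x +o B)"
      by (auto simp: coset_scale_def intro: set_plus_intro)
  qed
qed

text \<open>
  The K-linear maps between degree n cohomology spaces of two complexes (C, d) and (C', d') with
  scalar multiplications s and s'; being extensional, such a map is determined by its values on
  the cohomology space.
\<close>

definition cohomology_hom ::
    "('k \<Rightarrow> 'v \<Rightarrow> 'v) \<Rightarrow> (nat \<Rightarrow> 'v set) \<Rightarrow> (nat \<Rightarrow> 'v \<Rightarrow> 'v) \<Rightarrow>
     ('k \<Rightarrow> 'w \<Rightarrow> 'w) \<Rightarrow> (nat \<Rightarrow> 'w set) \<Rightarrow> (nat \<Rightarrow> 'w \<Rightarrow> 'w) \<Rightarrow> nat \<Rightarrow>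
     ('v::ab_group_add set \<Rightarrow> 'w::ab_group_add set) set" where
  "cohomology_hom s C d s' C' d' n =
    {\<psi> \<in> cohomology C d n \<rightarrow>\<^sub>E cohomology C' d' n.
      (\<forall>X\<in>cohomology C d n. \<forall>Y\<in>cohomology C d n. \<psi> (X + Y) = \<psi> X + \<psi> Y) \<and>
      (\<forall>c. \<forall>X\<in>cohomology C d n.
        \<psi> (coset_scale s (coboundaries C d n) c X) = coset_scale s' (coboundaries C' d' n) c (\<psi> X))}"

end

theory Submission
  imports Defs
begin

text \<open>
  A linear map \<open>\<phi>\<close> that sends cocycles to cocycles and coboundaries to coboundaries descends to
  cohomology in exactly one way. Everything therefore rests on how \<open>\<phi> (F\<^sub>1, ..., F\<^sub>n) = \<Sum>i. F\<^sub>i\<close>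
  interacts with the coboundaries.

  Every term of the Hochschild coboundary of a cochain contains the product exactly once, either
  outside the cochain or as one of its arguments. So on multilinear cochains the coboundary of
  \<open>\<mu>\<^sub>1 + \<mu>\<^sub>2\<close> is \<open>\<delta>\<^sub>1 + \<delta>\<^sub>2\<close> (lemma \<open>hochschild_coboundary_sum_product\<close>). The entries of
  \<open>\<delta>\<^sub>c (F\<^sub>1, ..., F\<^sub>n)\<close> are sums of the terms \<open>\<delta>\<^sub>1 F\<^sub>i\<close> and \<open>\<delta>\<^sub>2 F\<^sub>i\<close>, and each of these terms occurs
  in exactly one entry; adding them all up gives \<open>\<Sum>i. (\<delta>\<^sub>1 + \<delta>\<^sub>2) F\<^sub>i\<close>, so \<open>\<phi>\<close> commutes with the coboundaries
  in degrees \<open>n \<ge> 1\<close> (lemma \<open>compat_to_hochschild_coboundary\<close>).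

  Degree 0 is different, since \<open>\<delta>\<^sub>c m\<close> is the common value of \<open>\<delta>\<^sub>1 m\<close> and \<open>\<delta>\<^sub>2 m\<close>, whereas the
  Hochschild coboundary of \<open>m\<close> for \<open>\<mu>\<^sub>1 + \<mu>\<^sub>2\<close> is their sum, twice that value. In characteristic 0
  the element \<open>m / 2\<close> shows that \<open>\<delta>\<^sub>c m\<close> is nevertheless a coboundary
  (lemma \<open>compat_to_hochschild_coboundary_0\<close>), which is what degree 1 cohomology requires.
\<close>

section \<open>Maps induced on cohomology\<close>

lemma subspace_cocycles:
  assumes "Vector_Spaces.linear s s (d n)" and "module.subspace s (C n)"
  shows "module.subspace s (cocycles C d n)"
proof -
  interpret l: Vector_Spaces.linear s s "d n" by fact
  have "cocycles C d n = C n \<inter> {z. d n z = 0}" by (auto simp: cocycles_def)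
  then show ?thesis
    using assms(2) l.subspace_kernel by (simp add: l.vs1.subspace_inter)
qed

lemma subspace_coboundaries:
  assumes "vector_space s" and "\<And>k. Vector_Spaces.linear s s (d k)"
    and "\<And>k. module.subspace s (C k)"
  shows "module.subspace s (coboundaries C d n)"
proof -
  interpret vector_space s by fact
  show ?thesis
  proof (cases n)
    case 0
    then show ?thesis by (simp add: coboundaries_def)
  next
    case (Suc k)
    interpret l: Vector_Spaces.linear s s "d k" by (rule assms(2))
    show ?thesis using Suc l.subspace_image[OF assms(3)] by (simp add: coboundaries_def)
  qed
qed

text \<open>
  The induced map can be written without choosing representatives: it sends a coset \<open>X\<close> to
  \<open>\<phi> ` X + B'\<close>, where \<open>B'\<close> is the space of coboundaries in the target. If \<open>X = z + B\<close> this is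
  \<open>\<phi> z + \<phi> ` B + B' = \<phi> z + B'\<close>, since \<open>\<phi> ` B \<subseteq> B'\<close>; hence it is well defined and linear.
\<close>

lemma ex1_induced_cohomology_hom:
  fixes s :: "'k::field \<Rightarrow> 'v::ab_group_add \<Rightarrow> 'v" and s' :: "'k \<Rightarrow> 'w::ab_group_add \<Rightarrow> 'w"
  assumes lin: "Vector_Spaces.linear s s' \<phi>"
    and Z: "module.subspace s (cocycles C d n)"
    and B: "module.subspace s (coboundaries C d n)"
    and B': "module.subspace s' (coboundaries C' d' n)"
    and ZZ: "\<phi> ` cocycles C d n \<subseteq> cocycles C' d' n"
    and BB: "\<phi> ` coboundaries C d n \<subseteq> coboundaries C' d' n"
  shows "\<exists>!\<psi>. \<psi> \<in> cohomology_hom s C d s' C' d' n \<and>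
    (\<forall>z\<in>cocycles C d n. \<psi> (cohomology_class C d n z) = cohomology_class C' d' n (\<phi> z))"
proof -
  interpret l: Vector_Spaces.linear s s' \<phi> by fact
  define \<psi> where "\<psi> = (\<lambda>X\<in>cohomology C d n. \<phi> ` X + coboundaries C' d' n)"
  have val: "\<psi> (z +o coboundaries C d n) = \<phi> z +o coboundaries C' d' n"
    if z: "z \<in> cocycles C d n" for z
  proof -
    have "\<phi> ` (z +o coboundaries C d n) + coboundaries C' d' n = \<phi> z +o coboundaries C' d' n"
    proof (intro equalityI subsetI)
      fix v assume "v \<in> \<phi> ` (z +o coboundaries C d n) + coboundaries C' d' n"
      then obtain b b' where b: "b \<in> coboundaries C d n" "b' \<in> coboundaries C' d' n"
        "v = \<phi> (z + b) + b'"
        by (auto simp: set_plus_def elt_set_plus_def)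
      then have "\<phi> b + b' \<in> coboundaries C' d' n" using BB B' l.vs2.subspace_add by blast
      then show "v \<in> \<phi> z +o coboundaries C' d' n"
        using b(3) by (auto simp: elt_set_plus_def l.add add.assoc)
    next
      fix v assume "v \<in> \<phi> z +o coboundaries C' d' n"
      moreover have "z \<in> z +o coboundaries C d n"
        using set_plus_intro2[OF l.vs1.subspace_0[OF B], of z] by simp
      ultimately show "v \<in> \<phi> ` (z +o coboundaries C d n) + coboundaries C' d' n"
        by (auto simp: elt_set_plus_def intro: set_plus_intro)
    qed
    moreover have "z +o coboundaries C d n \<in> cohomology C d n"
      using z by (auto simp: cohomology_def cohomology_class_def)
    ultimately show ?thesis by (simp add: \<psi>_def)
  qed
  have hom: "\<psi> \<in> cohomology_hom s C d s' C' d' n"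
    unfolding cohomology_hom_def
  proof (intro CollectI conjI ballI allI)
    have "\<psi> X \<in> cohomology C' d' n" if "X \<in> cohomology C d n" for X
      using that ZZ by (auto simp: cohomology_def cohomology_class_def val)
    then show "\<psi> \<in> cohomology C d n \<rightarrow>\<^sub>E cohomology C' d' n"
      by (auto simp: \<psi>_def)
  next
    fix X Y assume "X \<in> cohomology C d n" "Y \<in> cohomology C d n"
    then obtain x y where xy: "x \<in> cocycles C d n" "y \<in> cocycles C d n"
      "X = x +o coboundaries C d n" "Y = y +o coboundaries C d n"
      by (auto simp: cohomology_def cohomology_class_def)
    then show "\<psi> (X + Y) = \<psi> X + \<psi> Y"
      using l.vs1.subspace_add[OF Z, of x y]
      by (simp add: val l.add coset_plus_coset[OF l.vs1.vector_space_axioms B]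
          coset_plus_coset[OF l.vs2.vector_space_axioms B'])
  next
    fix c X assume "X \<in> cohomology C d n"
    then obtain x where x: "x \<in> cocycles C d n" "X = x +o coboundaries C d n"
      by (auto simp: cohomology_def cohomology_class_def)
    then show "\<psi> (coset_scale s (coboundaries C d n) c X)
        = coset_scale s' (coboundaries C' d' n) c (\<psi> X)"
      using l.vs1.subspace_scale[OF Z, of x c]
      by (simp add: val l.scale coset_scale_coset[OF l.vs1.vector_space_axioms B]
          coset_scale_coset[OF l.vs2.vector_space_axioms B'])
  qed
  have on_classes: "\<forall>z\<in>cocycles C d n.
      \<psi> (cohomology_class C d n z) = cohomology_class C' d' n (\<phi> z)"
    by (simp add: cohomology_class_def val)
  have unique: "\<chi> = \<psi>"
    if \<chi>: "\<chi> \<in> cohomology_hom s C d s' C' d' n"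
      and \<chi>_class: "\<forall>z\<in>cocycles C d n. \<chi> (cohomology_class C d n z) = cohomology_class C' d' n (\<phi> z)" for \<chi>
  proof (rule extensionalityI)
    show "\<chi> \<in> extensional (cohomology C d n)"
      using \<chi> by (auto simp: cohomology_hom_def PiE_def)
    show "\<psi> \<in> extensional (cohomology C d n)" by (simp add: \<psi>_def)
    fix X assume "X \<in> cohomology C d n"
    then obtain z where z: "z \<in> cocycles C d n" "X = cohomology_class C d n z"
      by (auto simp: cohomology_def)
    show "\<chi> X = \<psi> X"
      using bspec[OF \<chi>_class z(1)] val[OF z(1)]
      by (simp only: z(2) cohomology_class_def)
  qed
  show ?thesis
    by (rule ex1I[of _ \<psi>], rule conjI[OF hom on_classes]) (elim conjE, rule unique)
qed


section \<open>Linear structure on cochains and tuples\<close>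

lemma vector_space_cochain_scale:
  assumes "vector_space scale"
  shows "vector_space (cochain_scale scale)"
proof -
  interpret vector_space scale by fact
  show ?thesis
    by unfold_locales (auto simp: cochain_scale_def fun_eq_iff algebra_simps)
qed

lemma vector_space_tuple_scale:
  assumes "vector_space scale"
  shows "vector_space (tuple_scale scale)"
proof -
  interpret vector_space scale by fact
  show ?thesis
    by unfold_locales (auto simp: tuple_scale_def cochain_scale_def fun_eq_iff algebra_simps)
qed

lemma subspace_hochschild_cochains:
  assumes "vector_space scale"
  shows "module.subspace (cochain_scale scale) (hochschild_cochains scale n)"
proof -
  interpret vector_space scale by fact
  interpret F: vector_space "cochain_scale scale" by (rule vector_space_cochain_scale) fact
  interpret P: vector_space_pair scale scale ..
  show ?thesis
    unfolding F.subspace_def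
    by (auto simp: hochschild_cochains_def cochain_scale_def
        intro: P.linear_zero P.linear_compose_add P.linear_compose_scale_right)
qed

lemma linear_compat_to_hochschild:
  assumes "vector_space scale"
  shows "Vector_Spaces.linear (tuple_scale scale) (cochain_scale scale) (compat_to_hochschild n)"
proof -
  interpret vector_space scale by fact
  interpret F: vector_space "cochain_scale scale" by (rule vector_space_cochain_scale) fact
  interpret T: vector_space "tuple_scale scale" by (rule vector_space_tuple_scale) fact
  show ?thesis
    by unfold_locales
      (simp_all add: compat_to_hochschild_def tuple_scale_def sum.distrib F.scale_sum_right)
qed

lemma compat_to_hochschild_cochain:
  assumes "vector_space scale" and "n \<ge> 1" and "F \<in> compat_cochains scale mu1 mu2 n"
  shows "compat_to_hochschild n F \<in> hochschild_cochains scale n"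
proof -
  interpret F: vector_space "cochain_scale scale" by (rule vector_space_cochain_scale) fact
  show ?thesis
    unfolding compat_to_hochschild_def
    by (rule F.subspace_sum[OF subspace_hochschild_cochains[OF assms(1)]])
      (use assms in \<open>auto simp: compat_cochains_def\<close>)
qed


section \<open>Linearity of the Hochschild coboundary in the cochain and in the product\<close>

context associative_algebra
begin

lemma product_add_left: "mu (x + y) c = mu x c + mu y c"
  and product_add_right: "mu c (x + y) = mu c x + mu c y"
  and product_scale_left: "mu (scale r x) c = scale r (mu x c)"
  and product_scale_right: "mu c (scale r x) = scale r (mu c x)"
proof -
  interpret l: Vector_Spaces.linear scale scale "\<lambda>a. mu a c" by (rule linear_left)
  interpret r: Vector_Spaces.linear scale scale "\<lambda>b. mu c b" by (rule linear_right)
  show "mu (x + y) c = mu x c + mu y c" "mu c (x + y) = mu c x + mu c y"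
    "mu (scale r x) c = scale r (mu x c)" "mu c (scale r x) = scale r (mu c x)"
    by (rule l.add r.add l.scale r.scale)+
qed

lemma product_zero_left: "mu 0 c = 0"
  and product_zero_right: "mu c 0 = 0"
  using product_add_left[of 0 0 c] product_add_right[of c 0 0] by simp_all

lemma linear_hochschild_coboundary:
  "Vector_Spaces.linear (cochain_scale scale) (cochain_scale scale) (hochschild_coboundary scale mu n)"
proof -
  interpret F: vector_space "cochain_scale scale"
    by (rule vector_space_cochain_scale[OF vector_space_axioms])
  show ?thesis
  proof unfold_locales
    fix f g c
    show "hochschild_coboundary scale mu n (f + g) =
        hochschild_coboundary scale mu n f + hochschild_coboundary scale mu n g"
      by (simp add: hochschild_coboundary_def fun_eq_iff product_add_left product_add_right
          scale_right_distrib sum.distrib)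
    show "hochschild_coboundary scale mu n (cochain_scale scale c f) =
        cochain_scale scale c (hochschild_coboundary scale mu n f)"
      by (simp add: hochschild_coboundary_def cochain_scale_def fun_eq_iff product_scale_left
          product_scale_right scale_right_distrib scale_sum_right scale_left_commute[of _ c]
          del: scale_scale power_Suc)
  qed
qed

end

lemma hochschild_cochain_add_entry:
  assumes "f \<in> hochschild_cochains scale n" and "length ys + length zs + 1 = n"
  shows "f (ys @ (u + v) # zs) = f (ys @ u # zs) + f (ys @ v # zs)"
proof -
  have "Vector_Spaces.linear scale scale (\<lambda>x. f (xs[i := x]))" if "length xs = n" "i < n" for xs i
    using assms(1) that by (simp add: hochschild_cochains_def)
  from this[of "ys @ 0 # zs" "length ys"]
  interpret l: Vector_Spaces.linear scale scale "\<lambda>x. f ((ys @ 0 # zs)[length ys := x])"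
    using assms(2) by simp
  show ?thesis using l.add[of u v] by simp
qed

text \<open>
  The outer terms of the coboundary are additive in the product for every cochain; the inner
  terms, where the product enters as an argument of the cochain, need multilinearity.
\<close>

lemma hochschild_coboundary_sum_product:
  fixes f :: "'a::ab_group_add list \<Rightarrow> 'a"
  assumes "vector_space scale" and f: "f \<in> hochschild_cochains scale n"
  shows "hochschild_coboundary scale (sum_product mu1 mu2) n f =
    hochschild_coboundary scale mu1 n f + hochschild_coboundary scale mu2 n f"
proof
  interpret vector_space scale by fact
  fix xs :: "'a list"
  show "hochschild_coboundary scale (sum_product mu1 mu2) n f xs =
    (hochschild_coboundary scale mu1 n f + hochschild_coboundary scale mu2 n f) xs"
  proof (cases "length xs = n + 1")
    case True
    let ?t = "\<lambda>mu i. scale ((- 1) ^ i) (f (take (i - 1) xs @ [mu (xs ! (i - 1)) (xs ! i)] @ drop (i + 1) xs))"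
    have "(\<Sum>i = 1..n. ?t (sum_product mu1 mu2) i) = (\<Sum>i = 1..n. ?t mu1 i + ?t mu2 i)"
    proof (rule sum.cong[OF refl])
      fix i assume "i \<in> {1..n}"
      then have "length (take (i - 1) xs) + length (drop (i + 1) xs) + 1 = n"
        using True by auto
      from hochschild_cochain_add_entry[OF f this]
      show "?t (sum_product mu1 mu2) i = ?t mu1 i + ?t mu2 i"
        by (simp add: sum_product_def scale_right_distrib)
    qed
    also have "\<dots> = (\<Sum>i = 1..n. ?t mu1 i) + (\<Sum>i = 1..n. ?t mu2 i)"
      by (rule sum.distrib)
    finally show ?thesis
      using True unfolding hochschild_coboundary_def
      by (simp add: sum_product_def scale_right_distrib algebra_simps)
  qed (simp add: hochschild_coboundary_def)
qed


lemma sum_padded_shift: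
  fixes g :: "nat \<Rightarrow> 'v::comm_monoid_add"
  shows "(\<Sum>i = 1..n + 1. if 2 \<le> i then g (i - 1) else 0) = (\<Sum>i = 1..n. g i)"
  by (induction n) simp_all


section \<open>Summation as a map of complexes\<close>

context compatible_associative_algebra
begin

lemma subspace_compat_cochains:
  "module.subspace (tuple_scale scale) (compat_cochains scale mu1 mu2 n)"
proof -
  interpret F: vector_space "cochain_scale scale"
    by (rule vector_space_cochain_scale[OF A1.vector_space_axioms])
  interpret T: vector_space "tuple_scale scale"
    by (rule vector_space_tuple_scale[OF A1.vector_space_axioms])
  note H = subspace_hochschild_cochains[OF A1.vector_space_axioms]
  note alg = A1.product_add_left A1.product_add_right A1.product_scale_left A1.product_scale_right
    A2.product_add_left A2.product_add_right A2.product_scale_left A2.product_scale_right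
  show ?thesis
  proof (cases "n = 0")
    case False
    then show ?thesis
      unfolding T.subspace_def
      by (auto simp: compat_cochains_def tuple_scale_def
          intro: F.subspace_0[OF H] F.subspace_add[OF H] F.subspace_scale[OF H])
  next
    case True
    let ?comm = "\<lambda>m. \<forall>a. mu1 a m - mu1 m a = mu2 a m - mu2 m a"
    have comm_0: "?comm 0"
      by (simp add: A1.product_zero_left A1.product_zero_right A2.product_zero_left
          A2.product_zero_right)
    have comm_add: "?comm (m + m')" if "?comm m" "?comm m'" for m m'
      using that by (simp add: alg add_diff_add)
    have comm_scale: "?comm (scale c m)" if "?comm m" for c m
      using that by (simp add: alg flip: A1.scale_right_diff_distrib)
    have mem: "F \<in> compat_cochains scale mu1 mu2 n \<longleftrightarrow>
        F 1 \<in> hochschild_cochains scale 0 \<and> (\<forall>i. i \<noteq> 1 \<longrightarrow> F i = 0) \<and> ?comm (F 1 [])" for F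
      using True by (simp add: compat_cochains_def)
    show ?thesis
      unfolding T.subspace_def
    proof (intro conjI ballI allI)
      show "0 \<in> compat_cochains scale mu1 mu2 n"
        unfolding mem using F.subspace_0[OF H] comm_0 by simp
    next
      fix F G assume "F \<in> compat_cochains scale mu1 mu2 n" "G \<in> compat_cochains scale mu1 mu2 n"
      then show "F + G \<in> compat_cochains scale mu1 mu2 n"
        unfolding mem using F.subspace_add[OF H] comm_add[of "F 1 []" "G 1 []"] by simp
    next
      fix c F assume "F \<in> compat_cochains scale mu1 mu2 n"
      moreover from this have "?comm (tuple_scale scale c F 1 [])"
        unfolding mem tuple_scale_def cochain_scale_def using comm_scale by blast
      ultimately show "tuple_scale scale c F \<in> compat_cochains scale mu1 mu2 n"
        unfolding mem using F.subspace_scale[OF H] by (simp add: tuple_scale_def)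
    qed
  qed
qed

lemma linear_compat_coboundary:
  "Vector_Spaces.linear (tuple_scale scale) (tuple_scale scale) (compat_coboundary scale mu1 mu2 n)"
proof -
  interpret F: vector_space "cochain_scale scale"
    by (rule vector_space_cochain_scale[OF A1.vector_space_axioms])
  interpret T: vector_space "tuple_scale scale"
    by (rule vector_space_tuple_scale[OF A1.vector_space_axioms])
  interpret d1: Vector_Spaces.linear "cochain_scale scale" "cochain_scale scale"
    "hochschild_coboundary scale mu1 n" by (rule A1.linear_hochschild_coboundary)
  interpret d2: Vector_Spaces.linear "cochain_scale scale" "cochain_scale scale"
    "hochschild_coboundary scale mu2 n" by (rule A2.linear_hochschild_coboundary)
  show ?thesis
  proof unfold_locales
    fix F G c
    show "compat_coboundary scale mu1 mu2 n (F + G) =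
        compat_coboundary scale mu1 mu2 n F + compat_coboundary scale mu1 mu2 n G"
      by (rule ext, cases "n = 0")
        (auto simp: compat_coboundary_def d1.add d2.add A1.product_add_left
          A1.product_add_right fun_eq_iff)
    show "compat_coboundary scale mu1 mu2 n (tuple_scale scale c F) =
        tuple_scale scale c (compat_coboundary scale mu1 mu2 n F)"
    proof (cases "n = 0")
      case True
      then show ?thesis
        by (auto simp: compat_coboundary_def tuple_scale_def cochain_scale_def fun_eq_iff
          A1.product_scale_left A1.product_scale_right A1.scale_right_diff_distrib)
    next
      case False
      then show ?thesis
        by (intro ext) (simp add: compat_coboundary_def tuple_scale_def d1.scale d2.scale
          F.scale_right_distrib)
    qed
  qed
qed

lemma compat_to_hochschild_coboundary:
  assumes n: "n \<ge> 1" and F: "F \<in> compat_cochains scale mu1 mu2 n"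
  shows "compat_to_hochschild (n + 1) (compat_coboundary scale mu1 mu2 n F) =
    hochschild_coboundary scale (sum_product mu1 mu2) n (compat_to_hochschild n F)"
proof -
  let ?d1 = "hochschild_coboundary scale mu1 n" and ?d2 = "hochschild_coboundary scale mu2 n"
  interpret d1: Vector_Spaces.linear "cochain_scale scale" "cochain_scale scale" ?d1
    by (rule A1.linear_hochschild_coboundary)
  interpret d2: Vector_Spaces.linear "cochain_scale scale" "cochain_scale scale" ?d2
    by (rule A2.linear_hochschild_coboundary)
  \<comment> \<open>Padding both rows by zero turns the four cases for the entries into a single formula.\<close>
  have entry: "compat_coboundary scale mu1 mu2 n F i =
      (if i \<le> n then ?d1 (F i) else 0) + (if 2 \<le> i then ?d2 (F (i - 1)) else 0)"
    if "i \<in> {1..n + 1}" for i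
    using that n by (cases "i = n + 1") (auto simp: compat_coboundary_def)
  have "compat_to_hochschild (n + 1) (compat_coboundary scale mu1 mu2 n F) =
      (\<Sum>i = 1..n + 1. if i \<le> n then ?d1 (F i) else 0)
      + (\<Sum>i = 1..n + 1. if 2 \<le> i then ?d2 (F (i - 1)) else 0)"
    unfolding compat_to_hochschild_def sum.distrib[symmetric]
    by (rule sum.cong[OF refl entry])
  also have "(\<Sum>i = 1..n + 1. if i \<le> n then ?d1 (F i) else 0) = (\<Sum>i = 1..n. ?d1 (F i))"
    by simp
  also have "(\<Sum>i = 1..n + 1. if 2 \<le> i then ?d2 (F (i - 1)) else 0) = (\<Sum>i = 1..n. ?d2 (F i))"
    by (rule sum_padded_shift)
  also have "(\<Sum>i = 1..n. ?d1 (F i)) + (\<Sum>i = 1..n. ?d2 (F i)) =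
      ?d1 (compat_to_hochschild n F) + ?d2 (compat_to_hochschild n F)"
    by (simp only: compat_to_hochschild_def d1.sum d2.sum)
  also have "\<dots> = hochschild_coboundary scale (sum_product mu1 mu2) n (compat_to_hochschild n F)"
    using hochschild_coboundary_sum_product[OF A1.vector_space_axioms
        compat_to_hochschild_cochain[OF A1.vector_space_axioms n F]] by simp
  finally show ?thesis .
qed

text \<open>
  Here the factor 1/2 compensates for the two equal contributions of \<open>\<mu>\<^sub>1\<close> and \<open>\<mu>\<^sub>2\<close> to the
  coboundary of \<open>\<mu>\<^sub>1 + \<mu>\<^sub>2\<close>.
\<close>

lemma compat_to_hochschild_coboundary_0:
  assumes F: "F \<in> compat_cochains scale mu1 mu2 0"
  shows "compat_to_hochschild 1 (compat_coboundary scale mu1 mu2 0 F) =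
    hochschild_coboundary scale (sum_product mu1 mu2) 0 (cochain_scale scale (1 / 2) (F 1))"
proof
  fix xs
  define m where "m = F 1 []"
  show "compat_to_hochschild 1 (compat_coboundary scale mu1 mu2 0 F) xs =
    hochschild_coboundary scale (sum_product mu1 mu2) 0 (cochain_scale scale (1 / 2) (F 1)) xs"
  proof (cases "length xs = 1")
    case True
    then obtain a where xs: "xs = [a]" by (auto simp: length_Suc_conv)
    have "sum_product mu1 mu2 a m - sum_product mu1 mu2 m a =
        (mu1 a m - mu1 m a) + (mu2 a m - mu2 m a)"
      by (simp add: sum_product_def)
    also have "\<dots> = scale 2 (mu1 a m - mu1 m a)"
      using F A1.scale_left_distrib[of 1 1] by (simp add: compat_cochains_def m_def)
    finally have "mu1 a m - mu1 m a =
        scale (1 / 2) (sum_product mu1 mu2 a m - sum_product mu1 mu2 m a)" by simp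
    also have "\<dots> = sum_product mu1 mu2 a (scale (1 / 2) m) - sum_product mu1 mu2 (scale (1 / 2) m) a"
      by (simp add: sum_product_def A1.product_scale_left A1.product_scale_right
          A2.product_scale_left A2.product_scale_right A1.scale_right_diff_distrib
          A1.scale_right_distrib)
    finally show ?thesis
      by (simp add: xs compat_to_hochschild_def compat_coboundary_def hochschild_coboundary_def
          cochain_scale_def m_def)
  qed (simp add: compat_to_hochschild_def compat_coboundary_def hochschild_coboundary_def)
qed

lemma compat_to_hochschild_cocycles:
  assumes "n \<ge> 1"
  shows "compat_to_hochschild n `
      cocycles (compat_cochains scale mu1 mu2) (compat_coboundary scale mu1 mu2) n
    \<subseteq> cocycles (hochschild_cochains scale) (hochschild_coboundary scale (sum_product mu1 mu2)) n"
  using compat_to_hochschild_coboundary[OF assms, symmetric]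
    compat_to_hochschild_cochain[OF A1.vector_space_axioms assms]
  by (auto simp: cocycles_def) (simp add: compat_to_hochschild_def)

lemma compat_to_hochschild_coboundaries:
  assumes "n \<ge> 1"
  shows "compat_to_hochschild n `
      coboundaries (compat_cochains scale mu1 mu2) (compat_coboundary scale mu1 mu2) n
    \<subseteq> coboundaries (hochschild_cochains scale) (hochschild_coboundary scale (sum_product mu1 mu2)) n"
proof -
  interpret F: vector_space "cochain_scale scale"
    by (rule vector_space_cochain_scale[OF A1.vector_space_axioms])
  obtain k where n: "n = Suc k" using assms by (cases n) auto
  show ?thesis
  proof (cases "k = 0")
    case True
    have "cochain_scale scale (1 / 2) (F 1) \<in> hochschild_cochains scale 0"
      if "F \<in> compat_cochains scale mu1 mu2 0" for F
      using that F.subspace_scale[OF subspace_hochschild_cochains[OF A1.vector_space_axioms]]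
      by (simp add: compat_cochains_def)
    then show ?thesis
      using compat_to_hochschild_coboundary_0
      by (auto simp: n True coboundaries_def)
  next
    case False
    then show ?thesis
      using compat_to_hochschild_coboundary[of k]
        compat_to_hochschild_cochain[OF A1.vector_space_axioms, of k]
      by (auto simp: n coboundaries_def)
  qed
qed

end


theorem theorem3p4:
  fixes scale :: "'k::field_char_0 \<Rightarrow> 'a::ab_group_add \<Rightarrow> 'a"
    and mu1 mu2 :: "'a \<Rightarrow> 'a \<Rightarrow> 'a"
  assumes "compatible_associative_algebra scale mu1 mu2"
  defines "Cc \<equiv> compat_cochains scale mu1 mu2"
    and "dc \<equiv> compat_coboundary scale mu1 mu2"
    and "C \<equiv> hochschild_cochains scale"
    and "d \<equiv> hochschild_coboundary scale (sum_product mu1 mu2)"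
  shows "\<forall>n\<ge>1.
    compat_to_hochschild n ` Cc n \<subseteq> C n \<and>
    compat_to_hochschild n ` cocycles Cc dc n \<subseteq> cocycles C d n \<and>
    compat_to_hochschild n ` coboundaries Cc dc n \<subseteq> coboundaries C d n \<and>
    (\<exists>!\<psi>. \<psi> \<in> cohomology_hom (tuple_scale scale) Cc dc (cochain_scale scale) C d n \<and>
      (\<forall>F\<in>cocycles Cc dc n.
        \<psi> (cohomology_class Cc dc n F) = cohomology_class C d n (compat_to_hochschild n F)))"
proof (intro allI impI conjI)
  interpret compatible_associative_algebra scale mu1 mu2 by fact
  interpret S: associative_algebra scale "sum_product mu1 mu2" by (rule associative_sum_product)
  note V = A1.vector_space_axioms
  fix n :: nat assume n: "n \<ge> 1"
  show "compat_to_hochschild n ` Cc n \<subseteq> C n"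
    using compat_to_hochschild_cochain[OF V n] unfolding Cc_def C_def by blast
  show Z: "compat_to_hochschild n ` cocycles Cc dc n \<subseteq> cocycles C d n"
    unfolding Cc_def C_def dc_def d_def by (rule compat_to_hochschild_cocycles[OF n])
  show B: "compat_to_hochschild n ` coboundaries Cc dc n \<subseteq> coboundaries C d n"
    unfolding Cc_def C_def dc_def d_def by (rule compat_to_hochschild_coboundaries[OF n])
  show "\<exists>!\<psi>. \<psi> \<in> cohomology_hom (tuple_scale scale) Cc dc (cochain_scale scale) C d n \<and>
      (\<forall>F\<in>cocycles Cc dc n.
        \<psi> (cohomology_class Cc dc n F) = cohomology_class C d n (compat_to_hochschild n F))"
  proof (rule ex1_induced_cohomology_hom[OF linear_compat_to_hochschild[OF V] _ _ _ Z B])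
    show "module.subspace (tuple_scale scale) (cocycles Cc dc n)"
      unfolding Cc_def dc_def
      by (intro subspace_cocycles linear_compat_coboundary subspace_compat_cochains)
    show "module.subspace (tuple_scale scale) (coboundaries Cc dc n)"
      unfolding Cc_def dc_def
      by (intro subspace_coboundaries vector_space_tuple_scale V linear_compat_coboundary
          subspace_compat_cochains)
    show "module.subspace (cochain_scale scale) (coboundaries C d n)"
      unfolding C_def d_def
      by (intro subspace_coboundaries vector_space_cochain_scale V S.linear_hochschild_coboundary
          subspace_hochschild_cochains)
  qed
qed

end
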